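(* Let $\Omega\subset\mathbb{R}^d$ be a bounded domain, let $m>0$, and let $\psi:\mathbb{R}\to[0,\infty]$ be a convex lower semicontinuous function such that $D(\psi)=\{s\in\mathbb{R}:\psi(s)<\infty\}$ has nonempty interior and $\lim_{|s|\to+\infty}\psi(s)=+\infty$. Let $$J(f)=\int_\Omega j(x,u_f,f)\,dx,$$ where $u_f$ is the solution of $-\Delta u=f$ in $\Omega$, $u=0$ on $\partial\Omega$. Suppose that the functional $J$ is lower semicontinuous with respect to the weak $L^1(\Omega)$ topology, and that the integrand $j(x,s,z)$ satisfies the growth condition $$-c|s|^p-a(x)\le j(x,s,z),\qquad\text{with } c>0,\ a\in L^1(\Omega),\ p<\frac{d}{d-2}.$$ If, in addition, $\psi$ satisfies the superlinear growth condition $$\lim_{|s|\to+\infty}\frac{\psi(s)}{|s|}=+\infty,$$ then the optimization problem $$\min\Big\{\int_\Omega j(x,u_f,f)\,dx\ :\ \int_\Omega\psi(f)\,dx\le m\Big\}$$ admits at least one solution $f_{opt}\in L^1(\Omega)$.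
   Context: The control $f$ is the right-hand side of the Dirichlet problem and the admissible controls are those $f\in L^1(\Omega)$ with $\int_\Omega\psi(f)\,dx\le m$. For $f\in L^1(\Omega)$ the solution $u_f$ of $-\Delta u=f$ with zero boundary values belongs to $W^{1,q}_0(\Omega)$ for every $q<d/(d-1)$, hence to $L^p(\Omega)$ for every $p<d/(d-2)$. When $d=2$, $d/(d-2)$ is read as $+\infty$.
   Formalization: The formal theorem additionally assumes that at least one f in L^1(Ω) satisfies ∫ψ(f)dx ≤ m; without this the claim fails, e.g. ψ(s)=1+s², |Ω|=1, m=1/2 has no admissible control. *)

theory Defs
  imports "HOL-Analysis.Analysis"
begin

section \<open>Lower semicontinuity and convexity of extended-valued functions\<close>

definition lower_semicontinuous_map :: "'a topology \<Rightarrow> ('a \<Rightarrow> 'b::linorder) \<Rightarrow> bool" where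
  "lower_semicontinuous_map X F \<longleftrightarrow>
     (\<forall>x\<in>topspace X. \<forall>t<F x. \<exists>U. openin X U \<and> x \<in> U \<and> (\<forall>y\<in>U. t < F y))"

text \<open>The library's \<open>convex_on\<close> only covers real-valued functions. At the end points \<open>l = 0\<close> and
  \<open>l = 1\<close> the convention \<open>0 * \<infinity> = 0\<close> makes the inequality trivial.\<close>

definition convex_ennreal :: "(real \<Rightarrow> ennreal) \<Rightarrow> bool" where
  "convex_ennreal \<psi> \<longleftrightarrow>
     (\<forall>s t l. 0 \<le> l \<and> l \<le> 1 \<longrightarrow>
        \<psi> (l * s + (1 - l) * t) \<le> ennreal l * \<psi> s + ennreal (1 - l) * \<psi> t)"


section \<open>The spaces \<open>L\<^sup>1(\<Omega>)\<close>, \<open>L\<^sup>\<infinity>(\<Omega>)\<close> and the weak topology of \<open>L\<^sup>1(\<Omega>)\<close>\<close>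

text \<open>Elements are functions, not classes modulo equality almost everywhere. Values outside
  \<open>\<Omega>\<close> are irrelevant.\<close>

definition L1 :: "'a::euclidean_space set \<Rightarrow> ('a \<Rightarrow> real) set" where
  "L1 \<Omega> = {f. integrable (lebesgue_on \<Omega>) f}"

definition Linf :: "'a::euclidean_space set \<Rightarrow> ('a \<Rightarrow> real) set" where
  "Linf \<Omega> = {g \<in> borel_measurable (lebesgue_on \<Omega>). \<exists>C. AE x in lebesgue_on \<Omega>. \<bar>g x\<bar> \<le> C}"

text \<open>The initial topology on \<open>L\<^sup>1(\<Omega>)\<close> for the functionals \<open>f \<mapsto> \<integral> f g\<close> with \<open>g \<in> L\<^sup>\<infinity>(\<Omega>)\<close>, that
  is \<open>\<sigma>(L\<^sup>1, L\<^sup>\<infinity>)\<close>. Functions that agree almost everywhere are topologically indistinguishable.\<close>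

definition weak_L1 :: "'a::euclidean_space set \<Rightarrow> ('a \<Rightarrow> real) topology" where
  "weak_L1 \<Omega> =
     pullback_topology (L1 \<Omega>) (\<lambda>f. \<lambda>g\<in>Linf \<Omega>. LINT x|lebesgue_on \<Omega>. f x * g x)
       (product_topology (\<lambda>_. euclideanreal) (Linf \<Omega>))"

lemma topspace_weak_L1: "topspace (weak_L1 \<Omega>) = L1 \<Omega>"
  by (auto simp: weak_L1_def topspace_pullback_topology)


section \<open>Test functions and the spaces \<open>W\<^sub>0\<^sup>1\<^sup>,\<^sup>q(\<Omega>)\<close>\<close>

primrec C_k :: "nat \<Rightarrow> ('a::euclidean_space \<Rightarrow> real) \<Rightarrow> bool" where
  "C_k 0 \<phi> \<longleftrightarrow> continuous_on UNIV \<phi>"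
| "C_k (Suc k) \<phi> \<longleftrightarrow>
     (\<forall>x. \<phi> differentiable (at x)) \<and> (\<forall>b\<in>Basis. C_k k (\<lambda>x. frechet_derivative \<phi> (at x) b))"

definition test_functions :: "'a::euclidean_space set \<Rightarrow> ('a \<Rightarrow> real) set" where
  "test_functions \<Omega> =
     {\<phi>. (\<forall>k. C_k k \<phi>) \<and> (\<exists>K. compact K \<and> K \<subseteq> \<Omega> \<and> (\<forall>x. x \<notin> K \<longrightarrow> \<phi> x = 0))}"

definition grad :: "('a::euclidean_space \<Rightarrow> real) \<Rightarrow> 'a \<Rightarrow> 'a" where
  "grad \<phi> x = (\<Sum>b\<in>Basis. frechet_derivative \<phi> (at x) b *\<^sub>R b)"

text \<open>\<open>sobolev0 q \<Omega> u G\<close> says that \<open>u \<in> W\<^sub>0\<^sup>1\<^sup>,\<^sup>q(\<Omega>)\<close> and that \<open>G\<close> is its weak gradient: \<open>(u, G)\<close> is a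
  limit of pairs \<open>(\<phi>, \<nabla>\<phi>)\<close> of test functions in \<open>L\<^sup>q\<close>. That \<open>u\<close> and \<open>G\<close> are in \<open>L\<^sup>q\<close> follows.\<close>

definition sobolev0 ::
    "real \<Rightarrow> 'a::euclidean_space set \<Rightarrow> ('a \<Rightarrow> real) \<Rightarrow> ('a \<Rightarrow> 'a) \<Rightarrow> bool" where
  "sobolev0 q \<Omega> u G \<longleftrightarrow>
     u \<in> borel_measurable (lebesgue_on \<Omega>) \<and> G \<in> borel_measurable (lebesgue_on \<Omega>) \<and>
     (\<exists>\<phi>. (\<forall>n::nat. \<phi> n \<in> test_functions \<Omega>) \<and>
        (\<lambda>n. \<integral>\<^sup>+x. ennreal (\<bar>\<phi> n x - u x\<bar> powr q) \<partial>lebesgue_on \<Omega>) \<longlonglongrightarrow> 0 \<and>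
        (\<lambda>n. \<integral>\<^sup>+x. ennreal (norm (grad (\<phi> n) x - G x) powr q) \<partial>lebesgue_on \<Omega>) \<longlonglongrightarrow> 0)"


section \<open>The Dirichlet problem with data in \<open>L\<^sup>1(\<Omega>)\<close>\<close>

text \<open>The variational solution \<open>v \<in> H\<^sub>0\<^sup>1(\<Omega>)\<close> of \<open>-\<Delta>v = g\<close> for bounded \<open>g\<close>.\<close>

definition variational_solution ::
    "'a::euclidean_space set \<Rightarrow> ('a \<Rightarrow> real) \<Rightarrow> ('a \<Rightarrow> real) \<Rightarrow> bool" where
  "variational_solution \<Omega> g v \<longleftrightarrow>
     (\<exists>G. sobolev0 2 \<Omega> v G \<and>
        (\<forall>\<phi>\<in>test_functions \<Omega>.
           (LINT x|lebesgue_on \<Omega>. G x \<bullet> grad \<phi> x) = (LINT x|lebesgue_on \<Omega>. g x * \<phi> x)))"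

text \<open>The solution of \<open>-\<Delta>u = f\<close>, \<open>u = 0\<close> on \<open>\<partial>\<Omega>\<close>, for \<open>f \<in> L\<^sup>1(\<Omega>)\<close>, in the sense of Stampacchia:
  \<open>u\<close> lies in \<open>W\<^sub>0\<^sup>1\<^sup>,\<^sup>q(\<Omega>)\<close> for all \<open>1 \<le> q < d / (d - 1)\<close>, and \<open>\<integral> u (-\<Delta>v) = \<integral> f v\<close> for all bounded
  \<open>v \<in> H\<^sub>0\<^sup>1(\<Omega>)\<close> with bounded \<open>\<Delta>v\<close>. Taking for \<open>v\<close> a test function gives \<open>-\<Delta>u = f\<close> in the sense
  of distributions. The distributional equation alone does not determine \<open>u\<close> in these spaces on an
  arbitrary bounded domain: on a punctured ball the Green function with pole at the puncture solves
  it with \<open>f = 0\<close>. The duality formulation determines \<open>u\<close> up to a null set.\<close>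

definition dirichlet_solution ::
    "'a::euclidean_space set \<Rightarrow> ('a \<Rightarrow> real) \<Rightarrow> ('a \<Rightarrow> real) \<Rightarrow> bool" where
  "dirichlet_solution \<Omega> f u \<longleftrightarrow>
     (\<forall>q. 1 \<le> q \<and> q * (real DIM('a) - 1) < real DIM('a) \<longrightarrow> (\<exists>G. sobolev0 q \<Omega> u G)) \<and>
     (\<forall>g\<in>Linf \<Omega>. \<forall>v\<in>Linf \<Omega>. variational_solution \<Omega> g v \<longrightarrow>
        (LINT x|lebesgue_on \<Omega>. u x * g x) = (LINT x|lebesgue_on \<Omega>. f x * v x))"

definition dirichlet_sol :: "'a::euclidean_space set \<Rightarrow> ('a \<Rightarrow> real) \<Rightarrow> 'a \<Rightarrow> real" where
  "dirichlet_sol \<Omega> f = (SOME u. dirichlet_solution \<Omega> f u)"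

text \<open>The chosen representative depends only on the class of \<open>f\<close> modulo equality almost everywhere.\<close>

lemma dirichlet_sol_cong_AE:
  assumes "f \<in> L1 \<Omega>" "f' \<in> L1 \<Omega>" "AE x in lebesgue_on \<Omega>. f x = f' x"
  shows "dirichlet_sol \<Omega> f = dirichlet_sol \<Omega> f'"
proof -
  have "(LINT x|lebesgue_on \<Omega>. f x * v x) = (LINT x|lebesgue_on \<Omega>. f' x * v x)"
    if "v \<in> Linf \<Omega>" for v
    using assms that by (intro integral_cong_AE) (auto simp: L1_def Linf_def)
  then have "dirichlet_solution \<Omega> f = dirichlet_solution \<Omega> f'"
    by (auto simp: dirichlet_solution_def fun_eq_iff)
  then show ?thesis
    by (simp add: dirichlet_sol_def)
qed


section \<open>The optimization problem\<close>

text \<open>The integral of an extended-real function as the difference of the integrals of its positive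
  and negative parts (\<open>e2ennreal\<close> sends negative numbers to \<open>0\<close>).\<close>

definition integral_ereal :: "'a measure \<Rightarrow> ('a \<Rightarrow> ereal) \<Rightarrow> ereal" where
  "integral_ereal M h =
     enn2ereal (\<integral>\<^sup>+x. e2ennreal (h x) \<partial>M) - enn2ereal (\<integral>\<^sup>+x. e2ennreal (- h x) \<partial>M)"

definition cost ::
    "'a::euclidean_space set \<Rightarrow> ('a \<Rightarrow> real \<Rightarrow> real \<Rightarrow> ereal) \<Rightarrow> ('a \<Rightarrow> real) \<Rightarrow> ereal" where
  "cost \<Omega> j f = integral_ereal (lebesgue_on \<Omega>) (\<lambda>x. j x (dirichlet_sol \<Omega> f x) (f x))"

definition admissible ::
    "'a::euclidean_space set \<Rightarrow> (real \<Rightarrow> ennreal) \<Rightarrow> real \<Rightarrow> ('a \<Rightarrow> real) set" where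
  "admissible \<Omega> \<psi> m = {f \<in> L1 \<Omega>. (\<integral>\<^sup>+x. \<psi> (f x) \<partial>lebesgue_on \<Omega>) \<le> ennreal m}"

end

theory Submission
  imports Defs
begin

text \<open>A lower semicontinuous function with values in a linear order attains its minimum on every
  nonempty compact set. This is true of \<open>cost \<Omega> j\<close> with values in \<open>[-\<infinity>, \<infinity>]\<close> as well; a possible
  value \<open>-\<infinity>\<close> is then itself the minimum. Everything therefore comes down to the weak compactness of
  \<open>{f. \<integral> \<psi>(f) \<le> m}\<close> in \<open>L\<^sup>1(\<Omega>)\<close> (\<open>compactin_admissible\<close>), which has three ingredients.

  First, superlinearity of \<open>\<psi>\<close> makes the admissible controls equi-integrable
  (\<open>equi_integrable_superlinear\<close>, after de la Vallee Poussin).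

  Second, equi-integrable families are relatively weakly compact (\<open>Dunford_Pettis\<close>). A function
  \<open>f \<in> L\<^sup>1\<close> is viewed as the functional \<open>g \<mapsto> \<integral> f g\<close> on \<open>L\<^sup>\<infinity>\<close>. By Tychonoff's theorem the functionals of
  a bounded family have compact closure in the topology of pointwise convergence, and it remains to see
  that the limits come from \<open>L\<^sup>1\<close> functions. For families of nonnegative functions a limit is a positive
  functional, equi-integrability makes it a countably additive measure on indicator functions, and the
  Radon-Nikodym theorem provides the density (\<open>positive_functional_density\<close>). Signed families are
  treated through the positive and negative parts: these have compact closures, and so does the family
  of all differences.

  Third, the constraint is weakly closed (\<open>sublevel_closed\<close>). The function \<open>\<psi>\<close> is the supremum of
  countably many affine minorants \<open>a s + b\<close>. Selecting among finitely many of them, in dependence of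
  \<open>x\<close>, one which is best at the limit \<open>f x\<close> gives bounded functions \<open>\<alpha>\<close>, \<open>\<beta>\<close> with
  \<open>\<alpha>(x) s + \<beta>(x) \<le> \<psi>(s)\<close> for all \<open>s\<close>. The inequality \<open>\<integral> \<alpha> f + \<beta> \<le> m\<close> is a condition on a single
  weakly continuous functional, so that it passes to the limit, and monotone convergence gives
  \<open>\<integral> \<psi>(f) \<le> m\<close>.\<close>

section \<open>Minima of lower semicontinuous functions on compact sets\<close>

text \<open>If every \<open>x\<close> in the compact set were beaten by some \<open>y\<close>, then, by lower semicontinuity, this \<open>y\<close>
  would beat a whole neighbourhood of \<open>x\<close>. The best one among the finitely many competitors of a finite
  subcover would then be beaten by another one of them.\<close>

lemma lower_semicontinuous_attains_min:
  fixes F :: "'a \<Rightarrow> 'b::linorder"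
  assumes F: "lower_semicontinuous_map X F" and K: "compactin X K" and ne: "K \<noteq> {}"
  shows "\<exists>x. is_arg_min F (\<lambda>x. x \<in> K) x"
proof (rule ccontr)
  assume "\<nexists>x. is_arg_min F (\<lambda>x. x \<in> K) x"
  then have no_min: "\<exists>y\<in>K. F y < F x" if "x \<in> K" for x
    using that by (auto simp: is_arg_min_def)
  define V where "V y = \<Union>{U. openin X U \<and> (\<forall>z\<in>U. F y < F z)}" for y
  have V_gt: "F y < F z" if "z \<in> V y" for y z
    using that by (auto simp: V_def)
  have "openin X (V y)" for y
    by (auto simp: V_def)
  moreover have "K \<subseteq> \<Union>(V ` K)"
  proof
    fix x assume "x \<in> K"
    with no_min obtain y where "y \<in> K" "F y < F x" by blast
    moreover have "x \<in> topspace X"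
      using \<open>x \<in> K\<close> K by (auto simp: compactin_def)
    ultimately show "x \<in> \<Union>(V ` K)"
      using F by (fastforce simp: V_def lower_semicontinuous_map_def)
  qed
  ultimately obtain \<F> where "finite \<F>" "\<F> \<subseteq> V ` K" "K \<subseteq> \<Union>\<F>"
    using K unfolding compactin_def by (metis (no_types, lifting) imageE)
  then obtain Y where Y: "finite Y" "Y \<subseteq> K" and cover: "K \<subseteq> \<Union>(V ` Y)"
    by (metis finite_subset_image)
  with ne have "Y \<noteq> {}" by auto
  define y where "y = arg_min_on F Y"
  have y: "y \<in> Y" and y_min: "\<And>z. z \<in> Y \<Longrightarrow> F y \<le> F z"
    using arg_min_if_finite[OF Y(1) \<open>Y \<noteq> {}\<close>, of F] by (auto simp: y_def not_less)
  from y Y cover obtain z where "z \<in> Y" "y \<in> V z" by blast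
  with V_gt y_min show False by (meson leD)
qed

lemma compactin_pullback_topology:
  assumes "S \<subseteq> A" "compactin T (f ` S)"
  shows "compactin (pullback_topology A f T) S"
  unfolding compactin_def
proof (intro conjI allI impI)
  show "S \<subseteq> topspace (pullback_topology A f T)"
    using assms by (auto simp: topspace_pullback_topology compactin_def)
next
  fix \<U> assume \<U>: "(\<forall>U\<in>\<U>. openin (pullback_topology A f T) U) \<and> S \<subseteq> \<Union>\<U>"
  then obtain W where W: "\<And>U. U \<in> \<U> \<Longrightarrow> openin T (W U)" "\<And>U. U \<in> \<U> \<Longrightarrow> U = f -` W U \<inter> A"
    unfolding openin_pullback_topology by metis
  have "f ` S \<subseteq> \<Union>(W ` \<U>)"
  proof
    fix y assume "y \<in> f ` S"
    then obtain x where "x \<in> S" "y = f x" by blast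
    moreover from \<open>x \<in> S\<close> \<U> obtain U where "U \<in> \<U>" "x \<in> U" by blast
    ultimately show "y \<in> \<Union>(W ` \<U>)" using W(2) by blast
  qed
  moreover have "\<forall>U\<in>W ` \<U>. openin T U"
    using W(1) by blast
  ultimately obtain \<G> where "finite \<G>" "\<G> \<subseteq> W ` \<U>" "f ` S \<subseteq> \<Union>\<G>"
    using assms(2) unfolding compactin_def by meson
  then obtain \<F> where \<F>: "finite \<F>" "\<F> \<subseteq> \<U>" "f ` S \<subseteq> \<Union>(W ` \<F>)"
    by (metis finite_subset_image)
  have "S \<subseteq> \<Union>\<F>"
  proof
    fix x assume "x \<in> S"
    with \<F> obtain U where "U \<in> \<F>" "f x \<in> W U" by blast
    with \<open>x \<in> S\<close> W(2)[of U] \<F>(2) assms(1) show "x \<in> \<Union>\<F>" by blast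
  qed
  with \<F> show "\<exists>\<F>. finite \<F> \<and> \<F> \<subseteq> \<U> \<and> S \<subseteq> \<Union>\<F>" by blast
qed

lemma closure_of_continuous_le:
  assumes "continuous_map X euclideanreal h" "\<And>y. y \<in> S \<Longrightarrow> h y \<le> c" "x \<in> X closure_of S"
  shows "h x \<le> (c::real)"
proof -
  have cl: "closedin X {y \<in> topspace X. h y \<in> {..c}}"
    by (rule closedin_continuous_map_preimage[OF assms(1)]) simp
  have "x \<in> X closure_of (topspace X \<inter> S)"
    using assms(3) by (simp add: closure_of_restrict[of X S])
  moreover have "topspace X \<inter> S \<subseteq> {y \<in> topspace X. h y \<in> {..c}}"
    using assms(2) by auto
  ultimately show ?thesis
    using closure_of_minimal[OF _ cl] by blast
qed

lemma closure_of_continuous_eq: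
  assumes "continuous_map X euclideanreal h" "\<And>y. y \<in> S \<Longrightarrow> h y = c" "x \<in> X closure_of S"
  shows "h x = (c::real)"
proof (rule antisym)
  show "h x \<le> c" using assms by (intro closure_of_continuous_le[of X h S c x]) auto
  have "- h x \<le> - c"
    using assms by (intro closure_of_continuous_le[of X "\<lambda>y. - h y" S "- c" x] continuous_intros) auto
  then show "c \<le> h x" by simp
qed

section \<open>Positive functionals on essentially bounded functions\<close>

definition ess_bounded :: "'a measure \<Rightarrow> ('a \<Rightarrow> real) set" where
  "ess_bounded M = {g \<in> borel_measurable M. \<exists>C. AE x in M. \<bar>g x\<bar> \<le> C}"

lemma ess_boundedI:
  "g \<in> borel_measurable M \<Longrightarrow> (\<And>x. \<bar>g x\<bar> \<le> C) \<Longrightarrow> g \<in> ess_bounded M"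
  by (auto simp: ess_bounded_def)

lemma ess_bounded_measurable [measurable_dest]: "g \<in> ess_bounded M \<Longrightarrow> g \<in> borel_measurable M"
  by (auto simp: ess_bounded_def)

lemma ess_bounded_const [simp, intro]: "(\<lambda>_. c) \<in> ess_bounded M"
  by (rule ess_boundedI[where C = "\<bar>c\<bar>"]) auto

lemma ess_bounded_indicator [simp, intro]: "A \<in> sets M \<Longrightarrow> indicator A \<in> ess_bounded M"
  by (rule ess_boundedI[where C = 1]) (auto simp: indicator_def)

lemma ess_bounded_add [intro]:
  assumes "g \<in> ess_bounded M" "h \<in> ess_bounded M"
  shows "(\<lambda>x. g x + h x) \<in> ess_bounded M"
proof -
  obtain C D where "AE x in M. \<bar>g x\<bar> \<le> C" "AE x in M. \<bar>h x\<bar> \<le> D"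
    using assms by (auto simp: ess_bounded_def)
  then have "AE x in M. \<bar>g x + h x\<bar> \<le> C + D"
    by eventually_elim linarith
  then show ?thesis
    using assms by (auto simp: ess_bounded_def)
qed

lemma ess_bounded_cmult [intro]:
  assumes "g \<in> ess_bounded M"
  shows "(\<lambda>x. c * g x) \<in> ess_bounded M"
proof -
  obtain C where "AE x in M. \<bar>g x\<bar> \<le> C"
    using assms by (auto simp: ess_bounded_def)
  then have "AE x in M. \<bar>c * g x\<bar> \<le> \<bar>c\<bar> * C"
    by eventually_elim (simp add: abs_mult mult_left_mono)
  then show ?thesis
    using assms by (auto simp: ess_bounded_def)
qed

lemma integrable_mult_ess_bounded [intro]:
  assumes f: "integrable M f" and g: "g \<in> ess_bounded M"
  shows "integrable M (\<lambda>x. f x * g x)"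
proof -
  obtain C where C: "AE x in M. \<bar>g x\<bar> \<le> C"
    using g by (auto simp: ess_bounded_def)
  have "integrable M (\<lambda>x. C * f x)" using f by simp
  moreover have "(\<lambda>x. f x * g x) \<in> borel_measurable M"
    using f g by measurable
  moreover have "AE x in M. norm (f x * g x) \<le> norm (C * f x)"
    using C
  proof eventually_elim
    case (elim x)
    then have "\<bar>g x\<bar> \<le> \<bar>C\<bar>" by linarith
    then show ?case
      by (simp add: abs_mult mult.commute[of "\<bar>C\<bar>"] mult_left_mono)
  qed
  ultimately show ?thesis by (rule Bochner_Integration.integrable_bound)
qed

text \<open>With a bound \<open>C\<close> for \<open>\<bar>g\<bar>\<close>, the simple function is \<open>g + C\<close> rounded down to multiples of \<open>\<epsilon>\<close>, and
  \<open>c = - C\<close>. Splitting off the constant makes the simple function nonnegative, as the induction rule for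
  real simple functions requires.\<close>

lemma ess_bounded_simple_approx:
  assumes g: "g \<in> ess_bounded M" and \<epsilon>: "0 < \<epsilon>"
  obtains c s where "simple_function M s" "\<And>x. 0 \<le> s x" "AE x in M. \<bar>g x - (s x + c)\<bar> \<le> \<epsilon>"
proof -
  obtain C0 where C0: "AE x in M. \<bar>g x\<bar> \<le> C0"
    using g by (auto simp: ess_bounded_def)
  define C where "C = \<bar>C0\<bar>"
  have C: "AE x in M. \<bar>g x\<bar> \<le> C" and "0 \<le> C"
    using C0 by (auto simp: C_def elim!: eventually_mono)
  define s where "s x = \<epsilon> * of_int \<lfloor>(max (- C) (min C (g x)) + C) / \<epsilon>\<rfloor>" for x
  have meas: "s \<in> borel_measurable M"
    using g unfolding s_def by measurable
  have range: "s x \<in> (\<lambda>k. \<epsilon> * of_int k) ` {0..\<lfloor>2 * C / \<epsilon>\<rfloor>}" for x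
  proof -
    have "0 \<le> (max (- C) (min C (g x)) + C) / \<epsilon>" "(max (- C) (min C (g x)) + C) / \<epsilon> \<le> 2 * C / \<epsilon>"
      using \<epsilon> \<open>0 \<le> C\<close> by (auto intro!: divide_right_mono)
    then have "\<lfloor>(max (- C) (min C (g x)) + C) / \<epsilon>\<rfloor> \<in> {0..\<lfloor>2 * C / \<epsilon>\<rfloor>}"
      using floor_mono by fastforce
    then show ?thesis by (auto simp: s_def)
  qed
  have "finite (s ` space M)"
    by (rule finite_subset[of _ "(\<lambda>k. \<epsilon> * of_int k) ` {0..\<lfloor>2 * C / \<epsilon>\<rfloor>}"]) (use range in auto)
  then have simple: "simple_function M s"
    using meas by (simp add: simple_function_borel_measurable)
  have nonneg: "0 \<le> s x" for x
    using range[of x] \<epsilon> by auto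
  have close: "AE x in M. \<bar>g x - (s x + - C)\<bar> \<le> \<epsilon>"
    using C
  proof eventually_elim
    case (elim x)
    define y where "y = (g x + C) / \<epsilon>"
    have "s x = \<epsilon> * of_int \<lfloor>y\<rfloor>"
      using elim by (simp add: s_def y_def min_absorb2 max_absorb2 abs_le_iff)
    moreover have "g x + C = \<epsilon> * y" using \<epsilon> by (simp add: y_def)
    ultimately have "g x - (s x + - C) = \<epsilon> * (y - of_int \<lfloor>y\<rfloor>)"
      by (simp add: algebra_simps)
    moreover have "\<bar>y - of_int \<lfloor>y\<rfloor>\<bar> \<le> 1" by linarith
    ultimately show ?case using \<epsilon> by (simp add: abs_mult)
  qed
  from simple nonneg close show thesis by (rule that)
qed

text \<open>Applied to indicator functions, \<open>\<Lambda>\<close> is a finitely additive measure. The last hypothesis makes it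
  small on sets of small measure, which gives continuity at the empty set, hence countable additivity, and
  absolute continuity. The Radon-Nikodym density represents \<open>\<Lambda>\<close> first on simple functions; a uniform
  approximation then suffices because positivity bounds \<open>\<Lambda>\<close> on functions of size \<open>\<epsilon>\<close> by
  \<open>\<epsilon> * \<Lambda> 1\<close>.\<close>

theorem (in finite_measure) positive_functional_density:
  assumes additive: "\<And>g h. g \<in> ess_bounded M \<Longrightarrow> h \<in> ess_bounded M \<Longrightarrow> \<Lambda> (\<lambda>x. g x + h x) = \<Lambda> g + \<Lambda> h"
    and homogeneous: "\<And>c g. g \<in> ess_bounded M \<Longrightarrow> \<Lambda> (\<lambda>x. c * g x) = c * \<Lambda> g"
    and pos: "\<And>g. g \<in> ess_bounded M \<Longrightarrow> AE x in M. 0 \<le> g x \<Longrightarrow> (0::real) \<le> \<Lambda> g"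
    and ac: "\<And>\<eta>. 0 < \<eta> \<Longrightarrow> \<exists>K. \<forall>A\<in>sets M. \<Lambda> (indicator A) \<le> K * measure M A + \<eta>"
  obtains f where "integrable M f" "\<And>x. 0 \<le> f x"
    "\<And>g. g \<in> ess_bounded M \<Longrightarrow> \<Lambda> g = (\<integral>x. f x * g x \<partial>M)"
proof -
  have mono: "\<Lambda> g \<le> \<Lambda> h" if "g \<in> ess_bounded M" "h \<in> ess_bounded M" "AE x in M. g x \<le> h x" for g h
  proof -
    have "\<Lambda> (\<lambda>x. h x + (- 1) * g x) = \<Lambda> h + (- 1) * \<Lambda> g"
      using that by (subst additive) (auto simp only: homogeneous ess_bounded_cmult)
    moreover have "0 \<le> \<Lambda> (\<lambda>x. h x + (- 1) * g x)"
      using that by (intro pos ess_bounded_add ess_bounded_cmult) auto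
    ultimately show ?thesis by simp
  qed
  have \<Lambda>_cong: "\<Lambda> g = \<Lambda> h" if "g \<in> ess_bounded M" "h \<in> ess_bounded M" "AE x in M. g x = h x" for g h
    using that by (intro antisym mono) (auto elim: eventually_mono)

  (* The set function is a finite measure which is absolutely continuous with respect to M. *)
  define \<nu> where "\<nu> A = \<Lambda> (indicator A)" for A
  have \<nu>_nonneg: "0 \<le> \<nu> A" if "A \<in> sets M" for A
    using that by (auto simp: \<nu>_def intro!: pos)
  have \<nu>_Un: "\<nu> (A \<union> B) = \<nu> A + \<nu> B" if "A \<in> sets M" "B \<in> sets M" "A \<inter> B = {}" for A B
  proof -
    have "\<nu> (A \<union> B) = \<Lambda> (\<lambda>x. indicator A x + indicator B x)"
      unfolding \<nu>_def using that by (intro arg_cong[where f = \<Lambda>] ext) (auto simp: indicator_def)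
    then show ?thesis
      using that by (simp add: additive \<nu>_def)
  qed
  have \<nu>_empty: "\<nu> {} = 0"
    using \<nu>_Un[of "{}" "{}"] by simp
  have \<nu>_tendsto: "(\<lambda>i. \<nu> (A i)) \<longlonglongrightarrow> 0"
    if A: "\<And>i. A i \<in> sets M" "(\<lambda>i. measure M (A i)) \<longlonglongrightarrow> 0" for A :: "nat \<Rightarrow> 'a set"
  proof (rule LIMSEQ_I)
    fix r :: real assume "0 < r"
    then obtain K where K: "\<forall>A\<in>sets M. \<nu> A \<le> K * measure M A + r / 2"
      using ac[of "r / 2"] by (auto simp: \<nu>_def)
    have "(\<lambda>i. K * measure M (A i)) \<longlonglongrightarrow> K * 0"
      by (intro tendsto_intros A)
    then obtain n0 where "\<forall>n\<ge>n0. \<bar>K * measure M (A n)\<bar> < r / 2"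
      using \<open>0 < r\<close> by (auto dest!: LIMSEQ_D[where r = "r / 2"])
    then have n0: "\<bar>K * measure M (A n)\<bar> < r / 2" if "n \<ge> n0" for n
      using that by blast
    have "norm (\<nu> (A n) - 0) < r" if "n \<ge> n0" for n
    proof -
      have "\<nu> (A n) \<le> K * measure M (A n) + r / 2" "0 \<le> \<nu> (A n)"
        using K A(1) \<nu>_nonneg by auto
      with n0[OF that] show ?thesis by (simp add: abs_less_iff)
    qed
    then show "\<exists>n0. \<forall>n\<ge>n0. norm (\<nu> (A n) - 0) < r" by blast
  qed
  define N where "N = measure_of (space M) (sets M) (\<lambda>A. ennreal (\<nu> A))"
  have "countably_additive (sets M) (\<lambda>A. ennreal (\<nu> A))"
  proof (rule sets.empty_continuous_imp_countably_additive)
    show "positive (sets M) (\<lambda>A. ennreal (\<nu> A))"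
      by (simp add: positive_def \<nu>_empty)
    show "additive (sets M) (\<lambda>A. ennreal (\<nu> A))"
      by (auto simp: additive_def \<nu>_Un \<nu>_nonneg)
    show "\<forall>A\<in>sets M. ennreal (\<nu> A) \<noteq> \<infinity>" by simp
  next
    fix A :: "nat \<Rightarrow> 'a set"
    assume A: "range A \<subseteq> sets M" "decseq A" "(\<Inter>i. A i) = {}"
    have "(\<lambda>i. measure M (A i)) \<longlonglongrightarrow> measure M (\<Inter>i. A i)"
      using A by (intro finite_Lim_measure_decseq) auto
    then have "(\<lambda>i. \<nu> (A i)) \<longlonglongrightarrow> 0"
      using A by (intro \<nu>_tendsto) auto
    then show "(\<lambda>i. ennreal (\<nu> (A i))) \<longlonglongrightarrow> 0"
      using tendsto_ennrealI by fastforce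
  qed
  then have emeasure_N: "emeasure N A = ennreal (\<nu> A)" if "A \<in> sets M" for A
    unfolding N_def using that
    by (intro emeasure_measure_of_sigma sets.sigma_algebra_axioms) (auto simp: positive_def \<nu>_empty)
  have sets_N: "sets N = sets M" by (simp add: N_def)
  have "absolutely_continuous M N"
    unfolding absolutely_continuous_def
  proof
    fix A assume "A \<in> null_sets M"
    then have "A \<in> sets M" "measure M A = 0"
      by (auto simp: null_sets_def measure_def)
    then have "(\<lambda>_::nat. \<nu> A) \<longlonglongrightarrow> 0"
      by (intro \<nu>_tendsto) auto
    then have "\<nu> A = 0" by (simp add: LIMSEQ_const_iff)
    then show "A \<in> null_sets N"
      using \<open>A \<in> sets M\<close> by (auto simp: null_sets_def sets_N emeasure_N)
  qed
  then obtain F where F [measurable]: "F \<in> borel_measurable M" and density: "density M F = N"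
    using Radon_Nikodym sets_N by blast
  have N_eq: "(\<integral>\<^sup>+x. F x * indicator A x \<partial>M) = ennreal (\<nu> A)" if "A \<in> sets M" for A
    using that emeasure_N[OF that] by (simp add: emeasure_density flip: density)
  have "(\<integral>\<^sup>+x. F x \<partial>M) = ennreal (\<nu> (space M))"
    using N_eq[of "space M"] by (simp cong: nn_integral_cong)
  then have F_fin: "AE x in M. F x \<noteq> \<infinity>"
    by (intro nn_integral_PInf_AE) auto
  define f where "f x = enn2real (F x)" for x
  have [measurable]: "f \<in> borel_measurable M" unfolding f_def by measurable
  have f_nonneg: "0 \<le> f x" for x by (simp add: f_def)
  have f_F: "AE x in M. ennreal (f x) = F x"
    using F_fin by eventually_elim (simp add: f_def less_top)
  have f_ind: "integrable M (\<lambda>x. f x * indicator A x)" "(\<integral>x. f x * indicator A x \<partial>M) = \<nu> A"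
    if A [measurable]: "A \<in> sets M" for A
  proof -
    have "(\<integral>\<^sup>+x. ennreal (f x * indicator A x) \<partial>M) = (\<integral>\<^sup>+x. F x * indicator A x \<partial>M)"
      using f_F by (intro nn_integral_cong_AE) (auto elim!: eventually_mono simp: indicator_def)
    then have "has_bochner_integral M (\<lambda>x. f x * indicator A x) (\<nu> A)"
      using N_eq[OF A] \<nu>_nonneg[OF A] f_nonneg
      by (intro has_bochner_integral_nn_integral) auto
    then show "integrable M (\<lambda>x. f x * indicator A x)" "(\<integral>x. f x * indicator A x \<partial>M) = \<nu> A"
      by (auto simp: has_bochner_integral_iff)
  qed
  have f_int: "integrable M f"
    using f_ind(1)[of "space M"] by (simp cong: Bochner_Integration.integrable_cong)

  (* The representation extends from indicator functions to simple functions and then, by squeezing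
     between two simple functions at distance 2 \<epsilon>, to all essentially bounded functions. *)
  have simple: "s \<in> ess_bounded M \<and> \<Lambda> s = (\<integral>x. f x * s x \<partial>M)"
    if "simple_function M s" "\<And>x. 0 \<le> s x" for s
    using that(1)
  proof (induction rule: simple_function_induct_real)
    case (cong s t)
    obtain C where "AE x in M. \<bar>s x\<bar> \<le> C"
      using cong by (auto simp: ess_bounded_def)
    with cong(3) have "AE x in M. \<bar>t x\<bar> \<le> C"
      by eventually_elim simp
    then have t: "t \<in> ess_bounded M"
      using cong(2) by (auto simp: ess_bounded_def borel_measurable_simple_function)
    have "\<Lambda> t = \<Lambda> s"
      using cong t \<Lambda>_cong by metis
    also have "\<dots> = (\<integral>x. f x * t x \<partial>M)"
      using cong t f_int
      by (auto intro!: integral_cong_AE elim!: eventually_mono dest: ess_bounded_measurable)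
    finally show ?case using t by simp
  next
    case (set A)
    then show ?case by (simp add: f_ind \<nu>_def)
  next
    case (mult u c)
    then show ?case by (auto simp: homogeneous mult.left_commute)
  next
    case (add u v)
    then show ?case
      using f_int by (auto simp: additive distrib_left integrable_mult_ess_bounded)
  qed (rule that(2))
  have const: "\<Lambda> (\<lambda>_. c) = (\<integral>x. f x * c \<partial>M)" for c
  proof -
    have "\<Lambda> (\<lambda>x. c * 1) = c * \<Lambda> (\<lambda>_. 1)" by (rule homogeneous) simp
    with simple[of "\<lambda>_. 1"] show ?thesis by simp
  qed
  have "\<Lambda> g = (\<integral>x. f x * g x \<partial>M)" if g: "g \<in> ess_bounded M" for g
  proof -
    define I where "I = (\<integral>x. f x \<partial>M)"
    have "0 \<le> I" by (simp add: I_def f_nonneg)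
    have "\<bar>\<Lambda> g - (\<integral>x. f x * g x \<partial>M)\<bar> \<le> 2 * I * \<epsilon>" if "0 < \<epsilon>" for \<epsilon>
    proof -
      obtain c s where s: "simple_function M s" "\<And>x. 0 \<le> s x"
        and close: "AE x in M. \<bar>g x - (s x + c)\<bar> \<le> \<epsilon>"
        using ess_bounded_simple_approx[OF g \<open>0 < \<epsilon>\<close>] by metis
      have s_bd: "s \<in> ess_bounded M" using simple s by blast
      have rep: "\<Lambda> (\<lambda>x. s x + b) = (\<integral>x. f x * (s x + b) \<partial>M)" for b
        using s_bd f_int simple[OF s] by (simp add: additive const distrib_left integrable_mult_ess_bounded)
      have shift: "(\<integral>x. f x * (s x + (c + b)) \<partial>M) = (\<integral>x. f x * (s x + c) \<partial>M) + b * I" for b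
      proof -
        have "(\<integral>x. f x * (s x + (c + b)) \<partial>M) = (\<integral>x. f x * (s x + c) + b * f x \<partial>M)"
          by (simp add: algebra_simps)
        then show ?thesis
          using s_bd f_int by (simp add: I_def integrable_mult_ess_bounded ess_bounded_add)
      qed
      have up: "AE x in M. g x \<le> s x + (c + \<epsilon>)" and low: "AE x in M. s x + (c + - \<epsilon>) \<le> g x"
        using close by (eventually_elim, linarith)+
      have "\<Lambda> g \<le> \<Lambda> (\<lambda>x. s x + (c + \<epsilon>))" "\<Lambda> (\<lambda>x. s x + (c + - \<epsilon>)) \<le> \<Lambda> g"
        using g s_bd up low by (auto intro!: mono)
      moreover have "(\<integral>x. f x * g x \<partial>M) \<le> (\<integral>x. f x * (s x + (c + \<epsilon>)) \<partial>M)"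
        using up g s_bd f_int f_nonneg
        by (intro integral_mono_AE integrable_mult_ess_bounded ess_bounded_add ess_bounded_const)
           (auto elim!: eventually_mono intro: mult_left_mono)
      moreover have "(\<integral>x. f x * (s x + (c + - \<epsilon>)) \<partial>M) \<le> (\<integral>x. f x * g x \<partial>M)"
        using low g s_bd f_int f_nonneg
        by (intro integral_mono_AE integrable_mult_ess_bounded ess_bounded_add ess_bounded_const)
           (auto elim!: eventually_mono intro: mult_left_mono)
      ultimately show ?thesis
        using shift[of \<epsilon>] shift[of "- \<epsilon>"] by (simp only: rep) (simp add: algebra_simps abs_le_iff)
    qed
    note close = this
    have "\<bar>\<Lambda> g - (\<integral>x. f x * g x \<partial>M)\<bar> \<le> 0 + r" if "0 < r" for r
    proof -
      have "2 * I * (r / (2 * I + 1)) \<le> r"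
        using \<open>0 \<le> I\<close> that by (simp add: field_simps)
      moreover have "0 < r / (2 * I + 1)"
        using \<open>0 \<le> I\<close> that by simp
      ultimately show ?thesis
        using close by fastforce
    qed
    then have "\<bar>\<Lambda> g - (\<integral>x. f x * g x \<partial>M)\<bar> \<le> 0"
      by (rule field_le_epsilon)
    then show ?thesis by simp
  qed
  with f_int f_nonneg show thesis by (rule that)
qed

section \<open>Weak compactness of equi-integrable families\<close>

text \<open>On a finite measure space this is uniform integrability: boundedness in \<open>L\<^sup>1\<close> follows with
  \<open>A = space M\<close>, and small integrals on small sets follow since \<open>K\<close> does not depend on \<open>f\<close> and \<open>A\<close>. The
  form with \<open>K\<close> is preserved under weak limits and avoids choosing a threshold for the measure of \<open>A\<close>.\<close>

definition equi_integrable :: "'a measure \<Rightarrow> ('a \<Rightarrow> real) set \<Rightarrow> bool" where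
  "equi_integrable M S \<longleftrightarrow>
     (\<forall>f\<in>S. integrable M f) \<and>
     (\<forall>\<eta>>0. \<exists>K. \<forall>f\<in>S. \<forall>A\<in>sets M. (\<integral>x. \<bar>f x\<bar> * indicator A x \<partial>M) \<le> K * measure M A + \<eta>)"

text \<open>The image of \<open>f \<in> L\<^sup>1\<close> in the dual of \<open>L\<^sup>\<infinity>\<close>. Outside \<open>L\<^sup>\<infinity>\<close> it takes a default value because the
  points of a product topology are extensional functions.\<close>

definition pairing :: "'a measure \<Rightarrow> ('a \<Rightarrow> real) \<Rightarrow> ('a \<Rightarrow> real) \<Rightarrow> real" where
  "pairing M f = (\<lambda>g\<in>ess_bounded M. \<integral>x. f x * g x \<partial>M)"

text \<open>Pointwise convergence of arbitrary real functions on \<open>L\<^sup>\<infinity>\<close>, not only of linear ones: linearity is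
  recovered in the limit.\<close>

definition dual_topology :: "'a measure \<Rightarrow> (('a \<Rightarrow> real) \<Rightarrow> real) topology" where
  "dual_topology M = product_topology (\<lambda>_. euclideanreal) (ess_bounded M)"

lemma pairing_in_topspace: "pairing M f \<in> topspace (dual_topology M)"
  by (simp add: dual_topology_def pairing_def)

lemma pairing_subset_closure: "pairing M ` S \<subseteq> dual_topology M closure_of (pairing M ` S)"
  by (rule closure_of_subset) (auto simp: pairing_in_topspace)

lemma pairing_eq: "g \<in> ess_bounded M \<Longrightarrow> pairing M f g = (\<integral>x. f x * g x \<partial>M)"
  by (simp add: pairing_def)

lemma continuous_map_eval [continuous_intros]:
  "g \<in> ess_bounded M \<Longrightarrow> continuous_map (dual_topology M) euclideanreal (\<lambda>\<Lambda>. \<Lambda> g)"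
  unfolding dual_topology_def by (rule continuous_map_product_projection)

lemma Hausdorff_dual_topology: "Hausdorff_space (dual_topology M)"
  by (simp add: dual_topology_def Hausdorff_space_product_topology)

lemma equi_integrable_dominated:
  assumes S: "equi_integrable M S"
    and T: "\<And>f. f \<in> S \<Longrightarrow> integrable M (T f)" "\<And>f x. f \<in> S \<Longrightarrow> \<bar>T f x\<bar> \<le> \<bar>f x\<bar>"
  shows "equi_integrable M (T ` S)"
  unfolding equi_integrable_def
proof (intro conjI allI impI)
  show "\<forall>f\<in>T ` S. integrable M f" using T by blast
next
  fix \<eta> :: real assume "0 < \<eta>"
  then obtain K where K: "\<And>f A. f \<in> S \<Longrightarrow> A \<in> sets M \<Longrightarrow>
      (\<integral>x. \<bar>f x\<bar> * indicator A x \<partial>M) \<le> K * measure M A + \<eta>"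
    using S unfolding equi_integrable_def by meson
  have "(\<integral>x. \<bar>T f x\<bar> * indicator A x \<partial>M) \<le> K * measure M A + \<eta>" if "f \<in> S" "A \<in> sets M" for f A
  proof -
    have "(\<integral>x. \<bar>T f x\<bar> * indicator A x \<partial>M) \<le> (\<integral>x. \<bar>f x\<bar> * indicator A x \<partial>M)"
      using S T that
      by (intro integral_mono integrable_real_mult_indicator integrable_abs mult_right_mono)
         (auto simp: equi_integrable_def)
    with K[OF that] show ?thesis by linarith
  qed
  then show "\<exists>K. \<forall>f\<in>T ` S. \<forall>A\<in>sets M. (\<integral>x. \<bar>f x\<bar> * indicator A x \<partial>M) \<le> K * measure M A + \<eta>"
    by blast
qed

text \<open>The family is bounded in \<open>L\<^sup>1\<close>, so its functionals lie in a product of compact intervals, which is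
  compact by Tychonoff's theorem.\<close>

lemma (in finite_measure) compactin_closure_pairing:
  assumes S: "equi_integrable M S"
  shows "compactin (dual_topology M) (dual_topology M closure_of (pairing M ` S))"
proof -
  obtain K where K: "\<And>f A. f \<in> S \<Longrightarrow> A \<in> sets M \<Longrightarrow>
      (\<integral>x. \<bar>f x\<bar> * indicator A x \<partial>M) \<le> K * measure M A + 1"
    using S unfolding equi_integrable_def by (meson zero_less_one)
  define B where "B = \<bar>K * measure M (space M) + 1\<bar>"
  have B: "(\<integral>x. \<bar>f x\<bar> \<partial>M) \<le> B" if "f \<in> S" for f
  proof -
    have "(\<integral>x. \<bar>f x\<bar> \<partial>M) = (\<integral>x. \<bar>f x\<bar> * indicator (space M) x \<partial>M)"
      by (rule Bochner_Integration.integral_cong) auto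
    with K[OF that, of "space M"] show ?thesis
      by (simp add: B_def)
  qed
  obtain C where C: "\<And>g. g \<in> ess_bounded M \<Longrightarrow> AE x in M. \<bar>g x\<bar> \<le> C g"
  proof -
    have "\<forall>g\<in>ess_bounded M. \<exists>C. AE x in M. \<bar>g x\<bar> \<le> C"
      by (auto simp: ess_bounded_def)
    then show ?thesis using that by (auto dest!: bchoice)
  qed
  have bound: "\<bar>\<integral>x. f x * g x \<partial>M\<bar> \<le> \<bar>C g\<bar> * B" if "f \<in> S" and g: "g \<in> ess_bounded M" for f g
  proof -
    have f: "integrable M f"
      using S \<open>f \<in> S\<close> by (simp add: equi_integrable_def)
    have "AE x in M. \<bar>f x * g x\<bar> \<le> \<bar>C g\<bar> * \<bar>f x\<bar>"
      using C[OF g]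
    proof eventually_elim
      case (elim x)
      then have "\<bar>g x\<bar> \<le> \<bar>C g\<bar>" by linarith
      then show ?case
        by (simp add: abs_mult mult.commute[of "\<bar>C g\<bar>"] mult_left_mono)
    qed
    then have "(\<integral>x. \<bar>f x * g x\<bar> \<partial>M) \<le> (\<integral>x. \<bar>C g\<bar> * \<bar>f x\<bar> \<partial>M)"
      using f g by (intro integral_mono_AE) (auto simp: integrable_mult_ess_bounded)
    then have "\<bar>\<integral>x. f x * g x \<partial>M\<bar> \<le> (\<integral>x. \<bar>C g\<bar> * \<bar>f x\<bar> \<partial>M)"
      using integral_abs_bound[of M "\<lambda>x. f x * g x"] by linarith
    also have "\<dots> = \<bar>C g\<bar> * (\<integral>x. \<bar>f x\<bar> \<partial>M)" by simp
    also have "\<dots> \<le> \<bar>C g\<bar> * B"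
      using B[OF \<open>f \<in> S\<close>] by (rule mult_left_mono) simp
    finally show ?thesis .
  qed
  define box where "box = (\<Pi>\<^sub>E g\<in>ess_bounded M. {- (\<bar>C g\<bar> * B)..\<bar>C g\<bar> * B})"
  have box: "compactin (dual_topology M) box"
    unfolding box_def dual_topology_def by (simp add: compactin_PiE)
  have "pairing M ` S \<subseteq> box"
    using bound by (fastforce simp: box_def pairing_def abs_le_iff)
  then have "dual_topology M closure_of (pairing M ` S) \<subseteq> box"
    by (rule closure_of_minimal) (rule compactin_imp_closedin[OF Hausdorff_dual_topology box])
  with box show ?thesis
    by (rule closed_compactin) simp
qed

text \<open>Linearity, positivity and the bounds of equi-integrability are equations and weak inequalities
  between finitely many values of a functional, and are thus inherited by pointwise limits. For nonnegative
  functions the bounds for \<open>\<integral>\<^sub>A \<bar>f\<bar>\<close> are bounds for the values at indicator functions.\<close>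

lemma (in finite_measure) closure_pairing_nonneg:
  assumes S: "equi_integrable M S" and nonneg: "\<And>f x. f \<in> S \<Longrightarrow> 0 \<le> f x"
  shows "dual_topology M closure_of (pairing M ` S) \<subseteq> pairing M ` {f. integrable M f}"
proof
  fix \<Lambda> assume \<Lambda>: "\<Lambda> \<in> dual_topology M closure_of (pairing M ` S)"
  have int: "integrable M (\<lambda>x. f x * g x)" if "f \<in> S" "g \<in> ess_bounded M" for f g
    using S that by (auto simp: equi_integrable_def)
  have additive: "\<Lambda> (\<lambda>x. g x + h x) = \<Lambda> g + \<Lambda> h"
    if [intro]: "g \<in> ess_bounded M" "h \<in> ess_bounded M" for g h
  proof -
    have "\<Lambda> (\<lambda>x. g x + h x) - (\<Lambda> g + \<Lambda> h) = 0"
    proof (rule closure_of_continuous_eq[OF _ _ \<Lambda>])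
      show "continuous_map (dual_topology M) euclideanreal (\<lambda>\<Lambda>. \<Lambda> (\<lambda>x. g x + h x) - (\<Lambda> g + \<Lambda> h))"
        by (intro continuous_intros) auto
    qed (use int in \<open>auto simp: pairing_eq ess_bounded_add that distrib_left\<close>)
    then show ?thesis by simp
  qed
  have homogeneous: "\<Lambda> (\<lambda>x. c * g x) = c * \<Lambda> g" if g [intro]: "g \<in> ess_bounded M" for c g
  proof -
    have "\<Lambda> (\<lambda>x. c * g x) - c * \<Lambda> g = 0"
    proof (rule closure_of_continuous_eq[OF _ _ \<Lambda>])
      show "continuous_map (dual_topology M) euclideanreal (\<lambda>\<Lambda>. \<Lambda> (\<lambda>x. c * g x) - c * \<Lambda> g)"
        by (intro continuous_intros) auto
    qed (auto simp: pairing_eq ess_bounded_cmult g mult.left_commute)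
    then show ?thesis by simp
  qed
  have positive: "0 \<le> \<Lambda> g" if g: "g \<in> ess_bounded M" and "AE x in M. 0 \<le> g x" for g
  proof -
    have "- \<Lambda> g \<le> 0"
    proof (rule closure_of_continuous_le[OF _ _ \<Lambda>])
      show "continuous_map (dual_topology M) euclideanreal (\<lambda>\<Lambda>. - \<Lambda> g)"
        using g by (intro continuous_intros) auto
    next
      fix \<Phi> assume "\<Phi> \<in> pairing M ` S"
      then obtain f where "f \<in> S" "\<Phi> = pairing M f" by blast
      moreover have "0 \<le> (\<integral>x. f x * g x \<partial>M)"
        using that(2) nonneg[OF \<open>f \<in> S\<close>] by (intro integral_nonneg_AE) (auto elim: eventually_mono)
      ultimately show "- \<Phi> g \<le> 0" using g by (simp add: pairing_eq)
    qed
    then show ?thesis by simp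
  qed
  have ac: "\<exists>K. \<forall>A\<in>sets M. \<Lambda> (indicator A) \<le> K * measure M A + \<eta>" if "0 < \<eta>" for \<eta>
  proof -
    obtain K where K: "\<And>f A. f \<in> S \<Longrightarrow> A \<in> sets M \<Longrightarrow>
        (\<integral>x. \<bar>f x\<bar> * indicator A x \<partial>M) \<le> K * measure M A + \<eta>"
      using S \<open>0 < \<eta>\<close> unfolding equi_integrable_def by meson
    have "\<Lambda> (indicator A) \<le> K * measure M A + \<eta>" if A: "A \<in> sets M" for A
      using A K nonneg
      by (intro closure_of_continuous_le[OF continuous_map_eval _ \<Lambda>]) (auto simp: pairing_eq)
    then show ?thesis by blast
  qed
  obtain f where f: "integrable M f" "\<And>g. g \<in> ess_bounded M \<Longrightarrow> \<Lambda> g = (\<integral>x. f x * g x \<partial>M)"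
    using positive_functional_density[of \<Lambda>, OF additive homogeneous positive ac] by metis
  have "\<Lambda> \<in> extensional (ess_bounded M)"
    using \<Lambda> closure_of_subset_topspace[of "dual_topology M"] by (auto simp: dual_topology_def PiE_def)
  then have "\<Lambda> = pairing M f"
    using f(2) by (auto simp: pairing_def extensional_def fun_eq_iff)
  with f(1) show "\<Lambda> \<in> pairing M ` {f. integrable M f}" by blast
qed

text \<open>The positive and negative parts of the members of \<open>S\<close> are equi-integrable families of nonnegative
  functions. The differences of elements of the closures of these two families form a compact, hence
  closed, set of functionals, which contains those of \<open>S\<close> and consists of functionals of \<open>L\<^sup>1\<close>
  functions.\<close>

theorem (in finite_measure) Dunford_Pettis:
  assumes S: "equi_integrable M S"
  shows "dual_topology M closure_of (pairing M ` S) \<subseteq> pairing M ` {f. integrable M f}"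
proof -
  define P where "P = (\<lambda>(f :: 'a \<Rightarrow> real) x. max 0 (f x)) ` S"
  define N where "N = (\<lambda>(f :: 'a \<Rightarrow> real) x. max 0 (- f x)) ` S"
  have int: "integrable M f" if "f \<in> S" for f
    using S that by (simp add: equi_integrable_def)
  have P: "equi_integrable M P" and N: "equi_integrable M N"
    unfolding P_def N_def using int by (auto intro!: equi_integrable_dominated[OF S])
  have cl: "dual_topology M closure_of (pairing M ` P) \<subseteq> pairing M ` {f. integrable M f}"
    "dual_topology M closure_of (pairing M ` N) \<subseteq> pairing M ` {f. integrable M f}"
    by (rule closure_pairing_nonneg[OF P], force simp: P_def)
       (rule closure_pairing_nonneg[OF N], force simp: N_def)
  define D :: "(('a \<Rightarrow> real) \<Rightarrow> real) \<times> (('a \<Rightarrow> real) \<Rightarrow> real) \<Rightarrow> ('a \<Rightarrow> real) \<Rightarrow> real"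
    where "D = (\<lambda>\<Phi>. \<lambda>g\<in>ess_bounded M. fst \<Phi> g - snd \<Phi> g)"
  have D_pairing: "D (pairing M f, pairing M h) = pairing M (\<lambda>x. f x - h x)"
    if "integrable M f" "integrable M h" for f h
    using that by (auto simp: D_def pairing_def fun_eq_iff left_diff_distrib integrable_mult_ess_bounded)
  define Q where "Q = D ` ((dual_topology M closure_of (pairing M ` P)) \<times>
    (dual_topology M closure_of (pairing M ` N)))"
  have "continuous_map (prod_topology (dual_topology M) (dual_topology M)) (dual_topology M) D"
  proof -
    have "continuous_map (prod_topology (dual_topology M) (dual_topology M)) euclideanreal
        (\<lambda>\<Phi>. D \<Phi> g)" if g: "g \<in> ess_bounded M" for g
    proof -
      have "continuous_map (prod_topology (dual_topology M) (dual_topology M)) euclideanreal (\<lambda>\<Phi>. fst \<Phi> g)"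
        using continuous_map_compose[OF continuous_map_fst continuous_map_eval[OF g]] by (simp add: o_def)
      moreover have "continuous_map (prod_topology (dual_topology M) (dual_topology M)) euclideanreal (\<lambda>\<Phi>. snd \<Phi> g)"
        using continuous_map_compose[OF continuous_map_snd continuous_map_eval[OF g]] by (simp add: o_def)
      ultimately show ?thesis
        using g by (simp add: D_def continuous_map_diff)
    qed
    then show ?thesis
      unfolding dual_topology_def[of M, THEN arg_cong[where f = "continuous_map _"], THEN fun_cong]
      by (auto simp: continuous_map_componentwise D_def)
  qed
  then have "compactin (dual_topology M) Q"
    unfolding Q_def
    by (intro image_compactin[of "prod_topology (dual_topology M) (dual_topology M)"])
       (simp add: compactin_Times compactin_closure_pairing P N)
  then have "closedin (dual_topology M) Q"
    by (rule compactin_imp_closedin[OF Hausdorff_dual_topology])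
  moreover have "pairing M ` S \<subseteq> Q"
  proof
    fix \<Phi> assume "\<Phi> \<in> pairing M ` S"
    then obtain f where f: "f \<in> S" "\<Phi> = pairing M f" by blast
    let ?p = "\<lambda>x. max 0 (f x)" and ?n = "\<lambda>x. max 0 (- f x)"
    have "\<Phi> = D (pairing M ?p, pairing M ?n)"
    proof -
      have "(\<lambda>x. ?p x - ?n x) = f" by (auto simp: max_def)
      then show ?thesis
        using int[OF f(1)] f(2) by (simp add: D_pairing)
    qed
    moreover have "pairing M ?p \<in> dual_topology M closure_of (pairing M ` P)"
      "pairing M ?n \<in> dual_topology M closure_of (pairing M ` N)"
      using f(1) by (auto simp: P_def N_def intro!: subsetD[OF pairing_subset_closure])
    ultimately show "\<Phi> \<in> Q" by (auto simp: Q_def)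
  qed
  ultimately have "dual_topology M closure_of (pairing M ` S) \<subseteq> Q"
    by (intro closure_of_minimal)
  also have "Q \<subseteq> pairing M ` {f. integrable M f}"
  proof
    fix \<Phi> assume "\<Phi> \<in> Q"
    then obtain \<Phi>\<^sub>1 \<Phi>\<^sub>2 where "\<Phi> = D (\<Phi>\<^sub>1, \<Phi>\<^sub>2)"
      "\<Phi>\<^sub>1 \<in> dual_topology M closure_of (pairing M ` P)"
      "\<Phi>\<^sub>2 \<in> dual_topology M closure_of (pairing M ` N)"
      unfolding Q_def by blast
    moreover from this cl obtain f h where "\<Phi>\<^sub>1 = pairing M f" "integrable M f"
      "\<Phi>\<^sub>2 = pairing M h" "integrable M h"
      by blast
    ultimately have "\<Phi> = D (pairing M f, pairing M h)" "integrable M f" "integrable M h"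
      by simp_all
    then show "\<Phi> \<in> pairing M ` {f. integrable M f}"
      by (auto simp: D_pairing)
  qed
  finally show ?thesis .
qed

section \<open>Affine minorants of convex lower semicontinuous functions\<close>

text \<open>For \<open>t < r < \<psi> s\<close> a line through \<open>(s, r)\<close> below the graph is needed. Its slope has to lie above all
  chord slopes from \<open>(s, r)\<close> to points of the graph on the left and below those to points on the right.
  Convexity orders these slopes. Lower semicontinuity at \<open>s\<close> bounds the left ones from above and the
  right ones from below, so that there is such a slope even when \<open>s\<close> is an end point of the domain or
  outside of it.\<close>

lemma affine_minorant_exists:
  assumes convex: "convex_ennreal \<psi>" and lsc: "lower_semicontinuous_map euclideanreal \<psi>"
    and "0 \<le> t" "ennreal t < \<psi> s"
  shows "\<exists>a b. (\<forall>x. ennreal (a * x + b) \<le> \<psi> x) \<and> t < a * s + b"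
proof -
  obtain r where "t < r" and r: "ennreal r < \<psi> s"
  proof -
    obtain e where e: "ennreal t < e" "e < \<psi> s"
      using dense[OF assms(4)] by blast
    then have "e \<noteq> \<infinity>" by auto
    then obtain r where "e = ennreal r" "0 \<le> r" by (cases e) auto
    with e \<open>0 \<le> t\<close> show thesis by (intro that[of r]) (auto simp: ennreal_less_iff)
  qed
  with \<open>0 \<le> t\<close> have "0 \<le> r" by simp
  define \<phi> where "\<phi> x = enn2real (\<psi> x)" for x
  have \<phi>: "\<psi> x = ennreal (\<phi> x)" if "\<psi> x < \<infinity>" for x
    using that by (simp add: \<phi>_def)
  have \<phi>_nonneg: "0 \<le> \<phi> x" for x by (simp add: \<phi>_def)
  obtain \<delta> where "0 < \<delta>" and near: "\<And>x. \<bar>x - s\<bar> < \<delta> \<Longrightarrow> ennreal r < \<psi> x"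
  proof -
    obtain U where "open U" "s \<in> U" "\<forall>y\<in>U. ennreal r < \<psi> y"
      using lsc r by (auto simp: lower_semicontinuous_map_def) meson
    then show thesis
      using that by (metis dist_real_def open_dist)
  qed
  define \<sigma> where "\<sigma> x = (\<phi> x - r) / (x - s)" for x
  define L where "L = {x. \<psi> x < \<infinity> \<and> x < s}"
  define R where "R = {x. \<psi> x < \<infinity> \<and> s < x}"
  have sep: "\<sigma> y \<le> \<sigma> x" if "y \<in> L" "x \<in> R" for y x
  proof -
    have yx: "y < s" "s < x" and fin: "\<psi> y = ennreal (\<phi> y)" "\<psi> x = ennreal (\<phi> x)"
      using that \<phi> by (auto simp: L_def R_def)
    define l where "l = (x - s) / (x - y)"
    have l: "0 \<le> l" "l \<le> 1" using yx by (auto simp: l_def field_simps)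
    have l': "l * (x - y) = x - s" using yx by (simp add: l_def)
    then have "l * y + (1 - l) * x = s" by (simp add: algebra_simps)
    then have "\<psi> s \<le> ennreal l * \<psi> y + ennreal (1 - l) * \<psi> x"
      using convex l unfolding convex_ennreal_def by metis
    also have "\<dots> = ennreal (l * \<phi> y + (1 - l) * \<phi> x)"
      using l \<phi>_nonneg by (simp add: fin flip: ennreal_mult ennreal_plus)
    finally have "ennreal r < ennreal (l * \<phi> y + (1 - l) * \<phi> x)"
      using r by order
    then have "r < l * \<phi> y + (1 - l) * \<phi> x"
      using \<open>0 \<le> r\<close> by (simp add: ennreal_less_iff)
    then have "r * (x - y) < (l * \<phi> y + (1 - l) * \<phi> x) * (x - y)"
      using yx by (simp add: mult_strict_right_mono)
    also have "\<dots> = (l * (x - y)) * \<phi> y + ((x - y) - l * (x - y)) * \<phi> x"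
      by (simp add: algebra_simps)
    finally have "r * (x - y) < (x - s) * \<phi> y + (s - y) * \<phi> x"
      by (simp add: l')
    then have "(r - \<phi> y) * (x - s) \<le> (\<phi> x - r) * (s - y)"
      by (simp add: algebra_simps)
    then have "(r - \<phi> y) / (s - y) \<le> (\<phi> x - r) / (x - s)"
      using yx by (simp add: divide_simps mult.commute)
    moreover have "(r - \<phi> y) / (s - y) = \<sigma> y"
      using yx by (simp add: \<sigma>_def divide_simps) (simp add: algebra_simps)
    ultimately show ?thesis by (simp add: \<sigma>_def)
  qed
  (* The chord slopes are at most k on the left of s and at least - k on its right: within distance
     \<delta> of s the graph is above r, and farther away it is at least above 0. *)
  define k where "k = r / \<delta>"
  have "0 \<le> k" "k * \<delta> = r"
    using \<open>0 < \<delta>\<close> \<open>0 \<le> r\<close> by (auto simp: k_def)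
  have gap: "r - \<phi> x \<le> k * \<bar>x - s\<bar>" if "\<psi> x < \<infinity>" for x
  proof (cases "\<bar>x - s\<bar> < \<delta>")
    case True
    then have "r < \<phi> x"
      using near[OF True] \<phi>[OF that] \<open>0 \<le> r\<close> by (simp add: ennreal_less_iff)
    moreover have "0 \<le> k * \<bar>x - s\<bar>"
      using \<open>0 \<le> k\<close> by simp
    ultimately show ?thesis by linarith
  next
    case False
    then have "k * \<delta> \<le> k * \<bar>x - s\<bar>"
      using \<open>0 \<le> k\<close> by (intro mult_left_mono) auto
    with \<phi>_nonneg[of x] \<open>k * \<delta> = r\<close> show ?thesis by simp
  qed
  have L_le: "\<sigma> y \<le> k" if "y \<in> L" for y
    using that gap[of y] by (auto simp: L_def \<sigma>_def neg_divide_le_eq algebra_simps)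
  have R_ge: "- k \<le> \<sigma> x" if "x \<in> R" for x
    using that gap[of x] by (auto simp: R_def \<sigma>_def pos_le_divide_eq algebra_simps)
  (* Inserting - k makes the set nonempty when the domain has no points on the left of s. *)
  define a where "a = Sup (insert (- k) (\<sigma> ` L))"
  have bdd: "bdd_above (insert (- k) (\<sigma> ` L))"
    using L_le \<open>0 \<le> k\<close> by (intro bdd_aboveI[of _ "k"]) fastforce
  have a_ge: "\<sigma> y \<le> a" if "y \<in> L" for y
    unfolding a_def using that bdd by (intro cSup_upper) auto
  have a_le: "a \<le> \<sigma> x" if "x \<in> R" for x
    unfolding a_def using that R_ge sep by (intro cSup_least) auto
  have "ennreal (a * (x - s) + r) \<le> \<psi> x" for x
  proof (cases "\<psi> x < \<infinity>")
    case True
    consider "x = s" | "x \<in> L" | "x \<in> R"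
      using True less_linear[of x s] by (auto simp: L_def R_def)
    then show ?thesis
    proof cases
      case 1
      then show ?thesis using r by simp
    next
      case 2
      then have "a * (x - s) \<le> \<phi> x - r"
        using a_ge[OF 2] by (simp add: L_def \<sigma>_def neg_divide_le_eq)
      then show ?thesis by (simp add: \<phi>[OF True] ennreal_leI)
    next
      case 3
      then have "a * (x - s) \<le> \<phi> x - r"
        using a_le[OF 3] by (simp add: R_def \<sigma>_def pos_le_divide_eq)
      then show ?thesis by (simp add: \<phi>[OF True] ennreal_leI)
    qed
  qed (simp flip: less_top)
  moreover have "a * (x - s) + r = a * x + (r - a * s)" for x
    by (simp add: algebra_simps)
  ultimately have "\<forall>x. ennreal (a * x + (r - a * s)) \<le> \<psi> x" by metis
  with \<open>t < r\<close> show ?thesis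
    by (intro exI[of _ a] exI[of _ "r - a * s"]) simp
qed

text \<open>Each minorant covers the open half plane below its graph. The Lindelof property of the plane
  extracts countably many minorants whose half planes cover the same set.\<close>

lemma countable_affine_minorants:
  assumes "convex_ennreal \<psi>" "lower_semicontinuous_map euclideanreal \<psi>"
  obtains P where "countable P" "\<And>a b x. (a, b) \<in> P \<Longrightarrow> ennreal (a * x + b) \<le> \<psi> x"
    "\<And>t s. 0 \<le> t \<Longrightarrow> ennreal t < \<psi> s \<Longrightarrow> \<exists>(a, b)\<in>P. t < a * s + b"
proof -
  define minorants where "minorants = {(a, b). \<forall>x. ennreal (a * x + b) \<le> \<psi> x}"
  define epi where "epi = (\<lambda>(a, b). {(s, t). t < a * s + (b::real)})"
  have "open U" if "U \<in> epi ` minorants" for U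
    using that by (auto simp: epi_def case_prod_unfold intro!: open_Collect_less continuous_intros)
  then obtain \<F> where \<F>: "\<F> \<subseteq> epi ` minorants" "countable \<F>" "\<Union>\<F> = \<Union>(epi ` minorants)"
    by (rule Lindelof)
  then obtain P where P: "countable P" "P \<subseteq> minorants" "\<F> = epi ` P"
    using countable_subset_image by metis
  show thesis
  proof (rule that)
    show "countable P" by (rule P)
    show "ennreal (a * x + b) \<le> \<psi> x" if "(a, b) \<in> P" for a b x
      using that P by (auto simp: minorants_def)
    show "\<exists>(a, b)\<in>P. t < a * s + b" if "0 \<le> t" "ennreal t < \<psi> s" for t s
    proof -
      have "(s, t) \<in> \<Union>(epi ` minorants)"
        using affine_minorant_exists[OF assms that] by (auto simp: epi_def minorants_def)
      then have "(s, t) \<in> \<Union>(epi ` P)" using \<F> P by simp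
      then show ?thesis by (auto simp: epi_def)
    qed
  qed
qed

text \<open>Weak closedness of a convex constraint. A pair of bounded functions \<open>\<alpha>\<close>, \<open>\<beta>\<close> with
  \<open>\<alpha>(x) s + \<beta>(x) \<le> \<psi>(s)\<close> yields an inequality for the functional at the single test function \<open>\<alpha>\<close>, which
  survives in the closure. Taking \<open>\<alpha>\<close> and \<open>\<beta>\<close> from minorants that are nearly optimal at \<open>f x\<close> recovers
  \<open>\<psi>(f)\<close>.\<close>

lemma (in finite_measure) sublevel_closed:
  assumes convex: "convex_ennreal \<psi>" and lsc: "lower_semicontinuous_map euclideanreal \<psi>"
    and f: "integrable M f" and "0 \<le> m"
    and cl: "pairing M f \<in> dual_topology M closure_of
      (pairing M ` {f. integrable M f \<and> (\<integral>\<^sup>+x. \<psi> (f x) \<partial>M) \<le> ennreal m})"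
  shows "(\<integral>\<^sup>+x. \<psi> (f x) \<partial>M) \<le> ennreal m"
proof -
  have [measurable]: "f \<in> borel_measurable M" using f by simp
  have minorant_le: "(\<integral>x. f x * \<alpha> x + \<beta> x \<partial>M) \<le> m"
    if \<alpha>: "\<alpha> \<in> ess_bounded M" and \<beta>: "\<beta> \<in> ess_bounded M"
      and minorant: "\<And>x s. ennreal (s * \<alpha> x + \<beta> x) \<le> \<psi> s" for \<alpha> \<beta>
  proof -
    have int: "integrable M (\<lambda>x. h x * \<alpha> x)" "integrable M \<beta>" if "integrable M h" for h
      using that \<alpha> \<beta> integrable_mult_ess_bounded[of M "\<lambda>_. 1" \<beta>] by auto
    have "pairing M f \<alpha> \<le> m - (\<integral>x. \<beta> x \<partial>M)"
    proof (rule closure_of_continuous_le[OF continuous_map_eval[OF \<alpha>] _ cl])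
      fix \<Phi> assume "\<Phi> \<in> pairing M ` {f. integrable M f \<and> (\<integral>\<^sup>+x. \<psi> (f x) \<partial>M) \<le> ennreal m}"
      then obtain h where h: "integrable M h" "(\<integral>\<^sup>+x. \<psi> (h x) \<partial>M) \<le> ennreal m" "\<Phi> = pairing M h"
        by blast
      have "(\<integral>\<^sup>+x. ennreal (h x * \<alpha> x + \<beta> x) \<partial>M) \<le> ennreal m"
        using nn_integral_mono[OF minorant] h(2) by (rule order_trans)
      then have "enn2real (\<integral>\<^sup>+x. ennreal (h x * \<alpha> x + \<beta> x) \<partial>M) \<le> m"
        using \<open>0 \<le> m\<close> by (rule enn2real_leI[rotated])
      moreover have "(\<integral>x. h x * \<alpha> x + \<beta> x \<partial>M) \<le> enn2real (\<integral>\<^sup>+x. ennreal (h x * \<alpha> x + \<beta> x) \<partial>M)"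
        using int[OF h(1)] by (subst real_lebesgue_integral_def) auto
      ultimately show "\<Phi> \<alpha> \<le> m - (\<integral>x. \<beta> x \<partial>M)"
        using int[OF h(1)] \<alpha> by (simp add: h(3) pairing_eq)
    qed
    then show ?thesis
      using int[OF f] \<alpha> by (simp add: pairing_eq)
  qed
  obtain P where P: "countable P" "\<And>a b x. (a, b) \<in> P \<Longrightarrow> ennreal (a * x + b) \<le> \<psi> x"
    and P_sup: "\<And>t s. 0 \<le> t \<Longrightarrow> ennreal t < \<psi> s \<Longrightarrow> \<exists>(a, b)\<in>P. t < a * s + b"
    using countable_affine_minorants[OF convex lsc] by metis
  (* The pair (0, 0), a minorant because \<psi> is nonnegative, makes the maxima nonnegative. *)
  define p where "p = from_nat_into (insert (0, 0) P)"
  have p_range: "range p = insert (0, 0) P"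
    using P(1) by (simp add: p_def)
  (* At the point x, \<gamma> n x is a pair among (0, 0), p 0, ..., p (n - 1) with the largest value at f x,
     and h n x is this value. *)
  define \<gamma> where "\<gamma> = rec_nat (\<lambda>_. (0, 0)) (\<lambda>n \<gamma> x.
    if fst (\<gamma> x) * f x + snd (\<gamma> x) < fst (p n) * f x + snd (p n) then p n else \<gamma> x)"
  have \<gamma>_0: "\<gamma> 0 x = (0, 0)"
    and \<gamma>_Suc: "\<gamma> (Suc n) x = (if fst (\<gamma> n x) * f x + snd (\<gamma> n x) < fst (p n) * f x + snd (p n)
      then p n else \<gamma> n x)" for n x
    by (simp_all add: \<gamma>_def)
  define h where "h n x = f x * fst (\<gamma> n x) + snd (\<gamma> n x)" for n x
  have \<gamma>_minorant: "ennreal (s * fst (\<gamma> n x) + snd (\<gamma> n x)) \<le> \<psi> s" for n x s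
  proof -
    have "ennreal (s * fst (p n) + snd (p n)) \<le> \<psi> s" for n
      using P(2)[of "fst (p n)" "snd (p n)" s] p_range rangeI[of p n]
      by (cases "p n") (auto simp: mult.commute)
    then show ?thesis
      by (induction n) (auto simp: \<gamma>_0 \<gamma>_Suc)
  qed
  have \<gamma>_bounded: "(\<lambda>x. fst (\<gamma> n x)) \<in> ess_bounded M \<and> (\<lambda>x. snd (\<gamma> n x)) \<in> ess_bounded M" for n
  proof -
    have meas: "(\<lambda>x. fst (\<gamma> n x)) \<in> borel_measurable M" "(\<lambda>x. snd (\<gamma> n x)) \<in> borel_measurable M" for n
    proof (induction n)
      case (Suc n)
      note [measurable] = Suc
      { case 1 show ?case by (simp add: \<gamma>_Suc if_distrib[of fst] cong: if_cong) }
      { case 2 show ?case by (simp add: \<gamma>_Suc if_distrib[of snd] cong: if_cong) }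
    qed (simp_all add: \<gamma>_0)
    have "\<exists>C. \<forall>x. \<bar>fst (\<gamma> n x)\<bar> \<le> C \<and> \<bar>snd (\<gamma> n x)\<bar> \<le> C"
    proof (induction n)
      case (Suc n)
      then obtain C where C: "\<And>x. \<bar>fst (\<gamma> n x)\<bar> \<le> C \<and> \<bar>snd (\<gamma> n x)\<bar> \<le> C" by blast
      have "\<bar>fst (\<gamma> (Suc n) x)\<bar> \<le> max C (max \<bar>fst (p n)\<bar> \<bar>snd (p n)\<bar>) \<and>
          \<bar>snd (\<gamma> (Suc n) x)\<bar> \<le> max C (max \<bar>fst (p n)\<bar> \<bar>snd (p n)\<bar>)" for x
        using C[of x] by (auto simp: \<gamma>_Suc)
      then show ?case by blast
    qed (auto simp: \<gamma>_0)
    then show ?thesis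
      using meas ess_boundedI by metis
  qed
  have h_mono: "incseq (\<lambda>n. h n x)" for x
    by (rule incseq_SucI) (simp add: h_def \<gamma>_Suc mult.commute)
  have h_nonneg: "0 \<le> h n x" for n x
    using incseqD[OF h_mono, of 0 n x] by (simp add: h_def \<gamma>_0)
  have h_ge: "fst (p n) * f x + snd (p n) \<le> h (Suc n) x" for n x
    by (simp add: h_def \<gamma>_Suc mult.commute)
  have int_h: "integrable M (h n)" for n
    unfolding h_def using f \<gamma>_bounded[of n] integrable_mult_ess_bounded[of M "\<lambda>_. 1" "\<lambda>x. snd (\<gamma> n x)"]
    by auto
  have sup: "\<psi> (f x) = (SUP n. ennreal (h n x))" for x
  proof (rule antisym)
    show "(SUP n. ennreal (h n x)) \<le> \<psi> (f x)"
      by (rule SUP_least) (simp add: h_def \<gamma>_minorant)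
    show "\<psi> (f x) \<le> (SUP n. ennreal (h n x))"
    proof (rule ccontr)
      assume "\<not> ?thesis"
      then have less: "(SUP n. ennreal (h n x)) < \<psi> (f x)" by simp
      then obtain t where t: "(SUP n. ennreal (h n x)) = ennreal t" "0 \<le> t"
        by (cases "SUP n. ennreal (h n x)") auto
      with P_sup[of t "f x"] less obtain a b where "(a, b) \<in> P" "t < a * f x + b" by auto
      moreover from \<open>(a, b) \<in> P\<close> obtain n where "p n = (a, b)"
        using p_range by (metis insertI2 rangeE)
      ultimately have "t < h (Suc n) x"
        using h_ge[of n x] by simp
      moreover have "ennreal (h (Suc n) x) \<le> ennreal t"
        unfolding t(1)[symmetric] by (rule SUP_upper) simp
      ultimately show False
        using t(2) by (simp add: ennreal_le_iff)
    qed
  qed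
  have "(\<integral>\<^sup>+x. ennreal (h n x) \<partial>M) \<le> ennreal m" for n
  proof -
    have "(\<integral>\<^sup>+x. ennreal (h n x) \<partial>M) = ennreal (\<integral>x. h n x \<partial>M)"
      using int_h h_nonneg by (intro nn_integral_eq_integral) auto
    moreover have "(\<integral>x. h n x \<partial>M) \<le> m"
      unfolding h_def using \<gamma>_bounded \<gamma>_minorant by (intro minorant_le) auto
    ultimately show ?thesis by (simp add: ennreal_leI)
  qed
  moreover have "(\<integral>\<^sup>+x. \<psi> (f x) \<partial>M) = (SUP n. \<integral>\<^sup>+x. ennreal (h n x) \<partial>M)"
    unfolding sup using int_h h_mono
    by (intro nn_integral_monotone_convergence_SUP)
       (auto simp: incseq_def le_fun_def ennreal_leI)
  ultimately show ?thesis by (simp add: SUP_least)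
qed

section \<open>Existence of optimal controls\<close>

lemma lower_semicontinuous_map_borel_measurable:
  fixes \<psi> :: "'a::topological_space \<Rightarrow> 'b::{linorder_topology, second_countable_topology}"
  assumes "lower_semicontinuous_map euclidean \<psi>"
  shows "\<psi> \<in> borel_measurable borel"
proof (rule borel_measurableI_greater)
  fix t
  have "open {x. t < \<psi> x}"
    using assms by (subst open_subopen) (fastforce simp: lower_semicontinuous_map_def)
  then show "{x \<in> space borel. t < \<psi> x} \<in> sets borel" by simp
qed

text \<open>The criterion of de la Vallee Poussin. Beyond some \<open>K\<close>, superlinearity gives
  \<open>\<psi>(s) \<ge> (m / \<eta>) \<bar>s\<bar>\<close>. Hence \<open>\<bar>s\<bar> \<le> \<bar>K\<bar> + (\<eta> / m) \<psi>(s)\<close> for all \<open>s\<close>, which is integrated over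
  \<open>A\<close>.\<close>

lemma (in finite_measure) equi_integrable_superlinear:
  assumes superlinear: "((\<lambda>s. \<psi> s / ennreal \<bar>s\<bar>) \<longlongrightarrow> \<infinity>) at_infinity"
    and lsc: "lower_semicontinuous_map euclideanreal \<psi>" and "0 < m"
  shows "equi_integrable M {f. integrable M f \<and> (\<integral>\<^sup>+x. \<psi> (f x) \<partial>M) \<le> ennreal m}"
  unfolding equi_integrable_def
proof (intro conjI allI impI)
  fix \<eta> :: real assume "0 < \<eta>"
  have "eventually (\<lambda>s. ennreal (m / \<eta>) < \<psi> s / ennreal \<bar>s\<bar>) at_infinity"
    using superlinear by (rule order_tendstoD) simp
  then obtain K where K: "\<And>s. K \<le> \<bar>s\<bar> \<Longrightarrow> ennreal (m / \<eta>) < \<psi> s / ennreal \<bar>s\<bar>"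
    by (auto simp: eventually_at_infinity)
  have bound: "ennreal \<bar>s\<bar> \<le> ennreal \<bar>K\<bar> + ennreal (\<eta> / m) * \<psi> s" for s
  proof (cases "K \<le> \<bar>s\<bar> \<and> s \<noteq> 0")
    case True
    then have "ennreal (m / \<eta>) * ennreal \<bar>s\<bar> \<le> \<psi> s / ennreal \<bar>s\<bar> * ennreal \<bar>s\<bar>"
      using K[of s] by (intro mult_right_mono) auto
    also have "\<dots> = \<psi> s"
      using True by (simp add: ennreal_divide_times ennreal_mult_divide_eq)
    finally have "ennreal (\<eta> / m) * (ennreal (m / \<eta>) * ennreal \<bar>s\<bar>) \<le> ennreal (\<eta> / m) * \<psi> s"
      by (rule mult_left_mono) simp
    moreover have "ennreal (\<eta> / m) * (ennreal (m / \<eta>) * ennreal \<bar>s\<bar>) = ennreal \<bar>s\<bar>"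
      using \<open>0 < \<eta>\<close> \<open>0 < m\<close> by (simp flip: ennreal_mult)
    ultimately show ?thesis
      by (metis add_increasing zero_le)
  next
    case False
    then have "ennreal \<bar>s\<bar> \<le> ennreal \<bar>K\<bar>" by (intro ennreal_leI) auto
    then show ?thesis by (rule order_trans) simp
  qed
  have "(\<integral>x. \<bar>f x\<bar> * indicator A x \<partial>M) \<le> \<bar>K\<bar> * measure M A + \<eta>"
    if f: "integrable M f" "(\<integral>\<^sup>+x. \<psi> (f x) \<partial>M) \<le> ennreal m" and A: "A \<in> sets M" for f A
  proof -
    note [measurable] = borel_measurable_integrable[OF f(1)]
      lower_semicontinuous_map_borel_measurable[OF lsc]
    have "ennreal (\<bar>f x\<bar> * indicator A x) \<le> ennreal \<bar>K\<bar> * indicator A x + ennreal (\<eta> / m) * \<psi> (f x)" for x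
      using bound[of "f x"] by (auto simp: indicator_def)
    then have "(\<integral>\<^sup>+x. ennreal (\<bar>f x\<bar> * indicator A x) \<partial>M)
        \<le> (\<integral>\<^sup>+x. ennreal \<bar>K\<bar> * indicator A x + ennreal (\<eta> / m) * \<psi> (f x) \<partial>M)"
      by (rule nn_integral_mono)
    also have "\<dots> = ennreal \<bar>K\<bar> * emeasure M A + ennreal (\<eta> / m) * (\<integral>\<^sup>+x. \<psi> (f x) \<partial>M)"
      using A by (simp add: nn_integral_add nn_integral_cmult)
    also have "\<dots> \<le> ennreal \<bar>K\<bar> * emeasure M A + ennreal (\<eta> / m) * ennreal m"
      using f(2) by (intro add_left_mono mult_left_mono) auto
    also have "\<dots> = ennreal (\<bar>K\<bar> * measure M A + \<eta>)"
      using \<open>0 < \<eta>\<close> \<open>0 < m\<close> by (simp add: emeasure_eq_measure flip: ennreal_mult ennreal_plus)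
    finally have "(\<integral>\<^sup>+x. ennreal (\<bar>f x\<bar> * indicator A x) \<partial>M) \<le> ennreal (\<bar>K\<bar> * measure M A + \<eta>)" .
    moreover have "(\<integral>\<^sup>+x. ennreal (\<bar>f x\<bar> * indicator A x) \<partial>M) = ennreal (\<integral>x. \<bar>f x\<bar> * indicator A x \<partial>M)"
      using f(1) A by (intro nn_integral_eq_integral integrable_real_mult_indicator) auto
    ultimately have "ennreal (\<integral>x. \<bar>f x\<bar> * indicator A x \<partial>M) \<le> ennreal (\<bar>K\<bar> * measure M A + \<eta>)"
      by simp
    moreover have "0 \<le> \<bar>K\<bar> * measure M A + \<eta>"
      using \<open>0 < \<eta>\<close> by simp
    ultimately show ?thesis
      by (simp only: ennreal_le_iff)
  qed
  then show "\<exists>K. \<forall>f\<in>{f. integrable M f \<and> (\<integral>\<^sup>+x. \<psi> (f x) \<partial>M) \<le> ennreal m}. \<forall>A\<in>sets M.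
      (\<integral>x. \<bar>f x\<bar> * indicator A x \<partial>M) \<le> K * measure M A + \<eta>"
    by blast
qed simp

text \<open>By \<open>Dunford_Pettis\<close> and \<open>sublevel_closed\<close> the functionals of the admissible controls form a closed
  set, and this set is compact. The weak topology is the pullback of the topology of functionals.\<close>

lemma compactin_admissible:
  assumes "open \<Omega>" "bounded \<Omega>" "0 < m" "convex_ennreal \<psi>" "lower_semicontinuous_map euclideanreal \<psi>"
    and "((\<lambda>s. \<psi> s / ennreal \<bar>s\<bar>) \<longlongrightarrow> \<infinity>) at_infinity"
  shows "compactin (weak_L1 \<Omega>) (admissible \<Omega> \<psi> m)"
proof -
  define M where "M = lebesgue_on \<Omega>"
  interpret finite_measure M
    unfolding M_def
    using assms(1,2) by (intro finite_measure_lebesgue_on) (simp add: bounded_set_imp_lmeasurable)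
  define S where "S = {f. integrable M f \<and> (\<integral>\<^sup>+x. \<psi> (f x) \<partial>M) \<le> ennreal m}"
  have S: "admissible \<Omega> \<psi> m = S" "S \<subseteq> L1 \<Omega>"
    by (auto simp: admissible_def L1_def S_def M_def)
  have Linf: "Linf \<Omega> = ess_bounded M"
    by (simp add: Linf_def ess_bounded_def M_def)
  have equi: "equi_integrable M S"
    unfolding S_def by (rule equi_integrable_superlinear) fact+
  have "dual_topology M closure_of (pairing M ` S) \<subseteq> pairing M ` S"
  proof
    fix \<Phi> assume \<Phi>: "\<Phi> \<in> dual_topology M closure_of (pairing M ` S)"
    then obtain f where f: "integrable M f" "\<Phi> = pairing M f"
      using Dunford_Pettis[OF equi] by blast
    then have "(\<integral>\<^sup>+x. \<psi> (f x) \<partial>M) \<le> ennreal m"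
      using \<Phi> assms unfolding S_def by (intro sublevel_closed) auto
    with f show "\<Phi> \<in> pairing M ` S" by (auto simp: S_def)
  qed
  with pairing_subset_closure have "dual_topology M closure_of (pairing M ` S) = pairing M ` S"
    by blast
  then have "compactin (dual_topology M) (pairing M ` S)"
    using compactin_closure_pairing[OF equi] by simp
  then have "compactin (pullback_topology (L1 \<Omega>) (pairing M) (dual_topology M)) S"
    using S(2) by (rule compactin_pullback_topology[rotated])
  moreover have "weak_L1 \<Omega> = pullback_topology (L1 \<Omega>) (pairing M) (dual_topology M)"
    by (simp add: weak_L1_def pairing_def[abs_def] dual_topology_def Linf M_def[symmetric])
  ultimately show ?thesis by (simp add: S)
qed

theorem theorem3p1:
  fixes \<Omega> :: "'a::euclidean_space set"
    and m c p :: real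
    and \<psi> :: "real \<Rightarrow> ennreal"
    and j :: "'a \<Rightarrow> real \<Rightarrow> real \<Rightarrow> ereal"
    and a :: "'a \<Rightarrow> real"
  assumes "open \<Omega>" "connected \<Omega>" "bounded \<Omega>" "\<Omega> \<noteq> {}"
    and "m > 0"
    and "convex_ennreal \<psi>"
    and "lower_semicontinuous_map euclideanreal \<psi>"
    and "interior {s. \<psi> s < \<infinity>} \<noteq> {}"
    and "(\<psi> \<longlongrightarrow> \<infinity>) at_infinity"
    and "\<And>f. f \<in> L1 \<Omega> \<Longrightarrow>
           (\<lambda>x. j x (dirichlet_sol \<Omega> f x) (f x)) \<in> borel_measurable (lebesgue_on \<Omega>)"
    and "lower_semicontinuous_map (weak_L1 \<Omega>) (cost \<Omega> j)"
    and "c > 0"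
    and "a \<in> L1 \<Omega>"
    and "DIM('a) \<le> 2 \<or> p < real DIM('a) / (real DIM('a) - 2)"
    and "AE x in lebesgue_on \<Omega>. \<forall>s z. ereal (- c * \<bar>s\<bar> powr p - a x) \<le> j x s z"
    and "((\<lambda>s. \<psi> s / ennreal \<bar>s\<bar>) \<longlongrightarrow> \<infinity>) at_infinity"
    and "admissible \<Omega> \<psi> m \<noteq> {}"
  shows "\<exists>f_opt. is_arg_min (cost \<Omega> j) (\<lambda>f. f \<in> admissible \<Omega> \<psi> m) f_opt"
  using assms lower_semicontinuous_attains_min[OF assms(11) compactin_admissible]
  by blast

end
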